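(* Let $K$ be the Choi-Kraus operator space of a quantum channel $\mathcal{N}:\mathcal{L}(A')\to\mathcal{L}(B)$. Then $\kappa^{NS}(K)=\sqrt{\Upsilon(K)}$, so the one-shot NS-codes assisted zero-error quantum capacity of $K$ equals $\lfloor\sqrt{\Upsilon(K)}\rfloor$.
   Context: A quantum channel $\mathcal{N}(\rho)=\sum_j E_j\rho E_j^\dagger$ from $\mathcal{L}(A')$ to $\mathcal{L}(B)$; $A\cong A'$; the Choi matrix is $J_{AB}=\sum_{i,j}|i\rangle\langle j|_A\otimes\mathcal{N}(|i\rangle\langle j|_{A'})$, $K=\mathrm{span}\{E_j\}$, and $P_{AB}$ is the projection onto the support of $J_{AB}$. For $k>0$, $D^{NS}(K,k)$ is the maximum of $\operatorname{tr}P_{AB}(W_{AB}-\rho_A\otimes\mathbb{1}_B)$ over $W_{AB},\rho_A$ subject to $0\le W_{AB}\le\rho_A\otimes\mathbb{1}_B$, $\operatorname{tr}\rho_A=1$, $\operatorname{tr}_AW_{AB}=\frac{1}{k^2}\mathbb{1}_B$; and $\kappa^{NS}(K)=\max\{k\ge0: D^{NS}(K,k)=0\}$. The one-shot NS-assisted zero-error quantum capacity of $K$ is $\lfloor\kappa^{NS}(K)\rfloor$. The quantity $\Upsilon(K)$ (the NS-assisted zero-error classical capacity quantity of $K$) is the optimal value of: maximize $\operatorname{tr}S_A$ over operators $S_A$ on $A$ and $U_{AB}$ on $A\otimes B$ subject to $0\le U_{AB}\le S_A\otimes\mathbb{1}_B$, $\operatorname{tr}_AU_{AB}=\mathbb{1}_B$,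 $\operatorname{tr}P_{AB}(S_A\otimes\mathbb{1}_B-U_{AB})=0$. *)

theory Defs
  imports Complex_Main "Jordan_Normal_Form.Matrix"
begin

text \<open>Finite-dimensional conventions. System A (\<cong> A') has dimension dA, B has dimension dB.
  Operators are complex matrices (Jordan_Normal_Form). The composite system A\<otimes>B has
  dimension dA*dB, with basis vector |a\<rangle>\<otimes>|b\<rangle> at index a*dB+b (Kronecker convention).
  A channel N : L(A') \<rightarrow> L(B) is given by a list Es of Kraus operators (dB x dA matrices).\<close>

definition adj :: "complex mat \<Rightarrow> complex mat" where
  "adj A = mat (dim_col A) (dim_row A) (\<lambda>(i,j). cnj (A $$ (j,i)))"

definition mtrace :: "complex mat \<Rightarrow> complex" where
  "mtrace A = (\<Sum>i<dim_row A. A $$ (i,i))"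

definition msum :: "nat \<Rightarrow> nat \<Rightarrow> ('i \<Rightarrow> complex mat) \<Rightarrow> 'i set \<Rightarrow> complex mat" where
  "msum nr nc f I = mat nr nc (\<lambda>ij. \<Sum>x\<in>I. f x $$ ij)"

definition tensor :: "complex mat \<Rightarrow> complex mat \<Rightarrow> complex mat" where
  "tensor A B = mat (dim_row A * dim_row B) (dim_col A * dim_col B)
     (\<lambda>(i,j). A $$ (i div dim_row B, j div dim_col B) * B $$ (i mod dim_row B, j mod dim_col B))"

definition ptrace_A :: "nat \<Rightarrow> nat \<Rightarrow> complex mat \<Rightarrow> complex mat" where
  "ptrace_A dA dB W = mat dB dB (\<lambda>(b,b'). \<Sum>a<dA. W $$ (a*dB+b, a*dB+b'))"

definition ketbra :: "nat \<Rightarrow> nat \<Rightarrow> nat \<Rightarrow> complex mat" where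
  "ketbra d i j = mat d d (\<lambda>(a,b). if a = i \<and> b = j then 1 else 0)"

definition psd :: "nat \<Rightarrow> complex mat \<Rightarrow> bool" where
  "psd n A \<longleftrightarrow> A \<in> carrier_mat n n \<and>
     (\<forall>v \<in> carrier_vec n. Im ((A *\<^sub>v v) \<bullet>c v) = 0 \<and> 0 \<le> Re ((A *\<^sub>v v) \<bullet>c v))"

definition loewner_le :: "nat \<Rightarrow> complex mat \<Rightarrow> complex mat \<Rightarrow> bool" where
  "loewner_le n A B \<longleftrightarrow> A \<in> carrier_mat n n \<and> B \<in> carrier_mat n n \<and> psd n (B - A)"

definition is_channel :: "nat \<Rightarrow> nat \<Rightarrow> complex mat list \<Rightarrow> bool" where
  "is_channel dA dB Es \<longleftrightarrow> 0 < dA \<and> (\<forall>E \<in> set Es. E \<in> carrier_mat dB dA) \<and>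
     msum dA dA (\<lambda>k. adj (Es ! k) * Es ! k) {..<length Es} = 1\<^sub>m dA"

definition kraus_apply :: "nat \<Rightarrow> complex mat list \<Rightarrow> complex mat \<Rightarrow> complex mat" where
  "kraus_apply dB Es X = msum dB dB (\<lambda>k. Es ! k * X * adj (Es ! k)) {..<length Es}"

definition choi :: "nat \<Rightarrow> nat \<Rightarrow> complex mat list \<Rightarrow> complex mat" where
  "choi dA dB Es = msum (dA*dB) (dA*dB)
     (\<lambda>(i,j). tensor (ketbra dA i j) (kraus_apply dB Es (ketbra dA i j))) ({..<dA} \<times> {..<dA})"

definition col_space :: "nat \<Rightarrow> complex mat \<Rightarrow> complex vec set" where
  "col_space n M = {M *\<^sub>v v | v. v \<in> carrier_vec n}"

definition supp_proj :: "nat \<Rightarrow> complex mat \<Rightarrow> complex mat" where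
  "supp_proj n J = (SOME P. P \<in> carrier_mat n n \<and> P * P = P \<and> adj P = P \<and>
                          col_space n P = col_space n J)"

definition P_AB :: "nat \<Rightarrow> nat \<Rightarrow> complex mat list \<Rightarrow> complex mat" where
  "P_AB dA dB Es = supp_proj (dA*dB) (choi dA dB Es)"

definition is_max :: "real set \<Rightarrow> real \<Rightarrow> bool" where
  "is_max S v \<longleftrightarrow> v \<in> S \<and> (\<forall>x\<in>S. x \<le> v)"

definition DNS_vals :: "nat \<Rightarrow> nat \<Rightarrow> complex mat list \<Rightarrow> real \<Rightarrow> real set" where
  "DNS_vals dA dB Es k =
     {Re (mtrace (P_AB dA dB Es * (W - tensor \<rho> (1\<^sub>m dB)))) | W \<rho>.
        W \<in> carrier_mat (dA*dB) (dA*dB) \<and> \<rho> \<in> carrier_mat dA dA \<and>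
        psd (dA*dB) W \<and> loewner_le (dA*dB) W (tensor \<rho> (1\<^sub>m dB)) \<and>
        mtrace \<rho> = 1 \<and> ptrace_A dA dB W = complex_of_real (1 / k^2) \<cdot>\<^sub>m 1\<^sub>m dB}"

text \<open>D^NS(K,k) = max of the SDP (meaningful when the maximum exists).\<close>
definition DNS :: "nat \<Rightarrow> nat \<Rightarrow> complex mat list \<Rightarrow> real \<Rightarrow> real" where
  "DNS dA dB Es k = (THE v. is_max (DNS_vals dA dB Es k) v)"

text \<open>\<kappa>^NS(K) = max{k : D^NS(K,k) = 0} (k ranging over k > 0, where D^NS is defined);
  "D^NS(K,k) = 0" means the maximum of the SDP exists and equals 0.\<close>
definition kappa_NS :: "nat \<Rightarrow> nat \<Rightarrow> complex mat list \<Rightarrow> real" where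
  "kappa_NS dA dB Es = (GREATEST k. 0 < k \<and> is_max (DNS_vals dA dB Es k) 0)"

definition QNS0 :: "nat \<Rightarrow> nat \<Rightarrow> complex mat list \<Rightarrow> int" where
  "QNS0 dA dB Es = \<lfloor>kappa_NS dA dB Es\<rfloor>"

definition Ups_vals :: "nat \<Rightarrow> nat \<Rightarrow> complex mat list \<Rightarrow> real set" where
  "Ups_vals dA dB Es =
     {Re (mtrace S) | S U.
        S \<in> carrier_mat dA dA \<and> U \<in> carrier_mat (dA*dB) (dA*dB) \<and>
        psd (dA*dB) U \<and> loewner_le (dA*dB) U (tensor S (1\<^sub>m dB)) \<and>
        ptrace_A dA dB U = 1\<^sub>m dB \<and>
        mtrace (P_AB dA dB Es * (tensor S (1\<^sub>m dB) - U)) = 0}"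

definition Upsilon :: "nat \<Rightarrow> nat \<Rightarrow> complex mat list \<Rightarrow> real" where
  "Upsilon dA dB Es = (GREATEST v. v \<in> Ups_vals dA dB Es)"

end

theory Submission
  imports Defs "HOL-Computational_Algebra.Fundamental_Theorem_Algebra"
begin

text \<open>The substitution \<open>S = k\<^sup>2 \<rho>\<close>, \<open>U = k\<^sup>2 W\<close> turns points of the program for \<open>D\<^sup>N\<^sup>S(K,k)\<close>
  with value 0 into feasible points of the program for \<open>\<Upsilon>(K)\<close> with \<open>tr S = k\<^sup>2\<close>. As
  \<open>tr P(W - \<rho> \<otimes> 1) \<le> 0\<close> always holds, the value 0 is maximal as soon as it is attained, so
  \<open>D\<^sup>N\<^sup>S(K,k) = 0\<close> iff \<open>k\<^sup>2\<close> is a value of the program for \<open>\<Upsilon>(K)\<close>.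

  It remains to see that the latter program attains its maximum. The point \<open>S = |0><0|\<close>,
  \<open>U = S \<otimes> 1\<close> is feasible. If \<open>tr P(S \<otimes> 1 - U) = 0\<close>, then \<open>P(S \<otimes> 1 - U)P = 0\<close>, hence
  \<open>tr J(S \<otimes> 1 - U) = 0\<close>; as the channel preserves traces, \<open>tr S = tr J(S \<otimes> 1) = tr JU\<close>,
  which is bounded because \<open>U \<ge> 0\<close> and \<open>tr U = dB\<close>. Entries of positive semidefinite matrices
  are bounded by the trace, so the feasible set is compact.\<close>

subsection \<open>Orthogonal projection onto a column space\<close>

lemma mult_mat_index:
  "A \<in> carrier_mat n m \<Longrightarrow> B \<in> carrier_mat m l \<Longrightarrow> i < n \<Longrightarrow> j < l \<Longrightarrow>
   (A * B) $$ (i, j) = (\<Sum>k<m. A $$ (i, k) * B $$ (k, j))"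
  by (auto simp: scalar_prod_def lessThan_atLeast0 intro!: sum.cong)

lemma adj_carrier [simp]: "A \<in> carrier_mat n m \<Longrightarrow> adj A \<in> carrier_mat m n"
  by (auto simp: adj_def)

lemma adj_dim [simp]: "dim_row (adj A) = dim_col A" "dim_col (adj A) = dim_row A"
  by (auto simp: adj_def)

lemma adj_index [simp]: "i < dim_col A \<Longrightarrow> j < dim_row A \<Longrightarrow> adj A $$ (i, j) = cnj (A $$ (j, i))"
  by (auto simp: adj_def)

lemma adj_adj [simp]: "adj (adj A) = A"
  by (rule eq_matI) auto

lemma adj_mult:
  assumes "A \<in> carrier_mat n m" "B \<in> carrier_mat m l"
  shows "adj (A * B) = adj B * adj A"
proof (rule eq_matI)
  fix i j assume "i < dim_row (adj B * adj A)" "j < dim_col (adj B * adj A)"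
  then have ij: "i < l" "j < n" using assms by auto
  have "(adj B * adj A) $$ (i, j) = (\<Sum>k<m. adj B $$ (i, k) * adj A $$ (k, j))"
    using assms ij by (intro mult_mat_index) auto
  moreover have "adj (A * B) $$ (i, j) = cnj (\<Sum>k<m. A $$ (j, k) * B $$ (k, i))"
    using assms ij by (simp add: mult_mat_index[symmetric])
  ultimately show "adj (A * B) $$ (i, j) = (adj B * adj A) $$ (i, j)"
    using assms ij by (auto simp: mult.commute intro!: sum.cong)
qed (use assms in auto)

lemma adj_add: "A \<in> carrier_mat n m \<Longrightarrow> B \<in> carrier_mat n m \<Longrightarrow> adj (A + B) = adj A + adj B"
  by (rule eq_matI) auto

lemma adj_smult: "adj (c \<cdot>\<^sub>m A) = cnj c \<cdot>\<^sub>m adj A"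
  by (rule eq_matI) auto

lemma mtrace_eq: "A \<in> carrier_mat n m \<Longrightarrow> mtrace A = (\<Sum>i<n. A $$ (i, i))"
  by (auto simp: mtrace_def)

lemma mtrace_comm:
  assumes "A \<in> carrier_mat n m" "B \<in> carrier_mat m n"
  shows "mtrace (A * B) = mtrace (B * A)"
proof -
  have "mtrace (A * B) = (\<Sum>i<n. \<Sum>k<m. A $$ (i, k) * B $$ (k, i))"
    using assms by (simp add: mtrace_eq[of _ n n] mult_mat_index[of A n m B n] del: index_mult_mat)
  also have "\<dots> = (\<Sum>k<m. \<Sum>i<n. B $$ (k, i) * A $$ (i, k))"
    by (subst sum.swap) (simp add: mult.commute)
  also have "\<dots> = mtrace (B * A)"
    using assms by (simp add: mtrace_eq[of _ m m] mult_mat_index[of B m n A m] del: index_mult_mat)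
  finally show ?thesis .
qed

text \<open>The factor \<open>X\<close> keeps the columns of \<open>P\<close> inside the column space of \<open>M\<close>, while the first
  \<open>m\<close> columns of \<open>M\<close> are fixed by \<open>P\<close>; columns are n-by-1 matrices, so that adjoints of them
  make sense.\<close>
lemma gram_schmidt_projection:
  assumes M: "M \<in> carrier_mat n l"
  defines "e \<equiv> \<lambda>j. mat l 1 (\<lambda>(i, _). if i = j then 1 else 0) :: complex mat"
  shows "\<exists>P X. P \<in> carrier_mat n n \<and> X \<in> carrier_mat l n \<and> P * P = P \<and> adj P = P \<and> P = M * X \<and>
           (\<forall>j<m. P * (M * e j) = M * e j)"
proof (induction m)
  case 0
  have "adj (0\<^sub>m n n) = 0\<^sub>m n n" by (rule eq_matI) auto
  then show ?case using M
    by (intro exI[of _ "0\<^sub>m n n"] exI[of _ "0\<^sub>m l n"]) auto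
next
  case (Suc m)
  then obtain P X where P: "P \<in> carrier_mat n n" and X: "X \<in> carrier_mat l n" and PP: "P * P = P"
    and aP: "adj P = P" and PX: "P = M * X" and PM: "\<And>j. j < m \<Longrightarrow> P * (M * e j) = M * e j"
    by blast
  have e: "e j \<in> carrier_mat l 1" for j by (simp add: e_def)
  \<comment> \<open>One Gram-Schmidt step: \<open>c\<close> is the next column of \<open>M\<close>
    and \<open>r\<close> is what remains of it after applying \<open>P\<close>.\<close>
  define c where "c = M * e m"
  define r where "r = c - P * c"
  have c: "c \<in> carrier_mat n 1" using M e by (auto simp: c_def)
  have r: "r \<in> carrier_mat n 1" using P c by (auto simp: r_def)
  have ar: "adj r \<in> carrier_mat 1 n" using r by simp
  show ?case
  proof (cases "r = 0\<^sub>m n 1")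
    \<comment> \<open>The new column already lies in the range of \<open>P\<close>, so
      \<open>P\<close> can be kept.\<close>
    case True
    have "P * c = c"
    proof (rule eq_matI)
      fix i j assume ij: "i < dim_row c" "j < dim_col c"
      have "r $$ (i, j) = 0" using True ij c by auto
      then show "(P * c) $$ (i, j) = c $$ (i, j)" using ij c P by (simp add: r_def)
    qed (use P c in auto)
    then have "\<forall>j<Suc m. P * (M * e j) = M * e j" using PM by (metis less_Suc_eq c_def)
    with P X PP aP PX show ?thesis by blast
  next
    case False
    \<comment> \<open>\<open>N\<close> is the squared norm of \<open>r\<close>, hence nonzero here;
      it normalizes the rank-one projection \<open>Q\<close> onto \<open>r\<close>.\<close>
    define N where "N = (adj r * r) $$ (0, 0)"
    have N: "N = complex_of_real (\<Sum>i<n. (cmod (r $$ (i, 0)))\<^sup>2)"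
      unfolding N_def using r
      by (subst mult_mat_index[of _ 1 n _ 1])
         (auto simp: complex_norm_square mult.commute simp del: of_real_power intro!: sum.cong)
    have N0: "N \<noteq> 0"
    proof
      assume "N = 0"
      then have "(\<Sum>i<n. (cmod (r $$ (i, 0)))\<^sup>2) = 0" using N by (metis of_real_eq_0_iff)
      then have "\<forall>i<n. r $$ (i, 0) = 0" by (subst (asm) sum_nonneg_eq_0_iff) auto
      then have "r = 0\<^sub>m n 1" using r by (intro eq_matI) auto
      with False show False by simp
    qed
    have rr: "adj r * r = N \<cdot>\<^sub>m 1\<^sub>m 1" using r by (intro eq_matI) (auto simp: N_def)
    \<comment> \<open>The residual is orthogonal to the range of \<open>P\<close>. Together with the
      adjoint form this makes \<open>P\<close> and \<open>Q\<close> annihilate each other, so that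
      \<open>P + Q\<close> is again a projection.\<close>
    have Pr: "P * r = 0\<^sub>m n 1"
    proof -
      have "P * r = P * c - P * (P * c)" using P c unfolding r_def by (intro mult_minus_distrib_mat) auto
      also have "P * (P * c) = P * c" using P c PP by (metis assoc_mult_mat)
      finally show ?thesis using P c by auto
    qed
    have arP: "adj r * P = 0\<^sub>m 1 n"
    proof -
      have "adj (P * r) = adj r * P" using adj_mult[OF P r] aP by simp
      moreover have "adj (P * r) = 0\<^sub>m 1 n" unfolding Pr by (rule eq_matI) auto
      ultimately show ?thesis by simp
    qed
    define Q where "Q = (1 / N) \<cdot>\<^sub>m (r * adj r)"
    have Q: "Q \<in> carrier_mat n n" using r by (auto simp: Q_def)
    have Qv: "Q * v = (1 / N) \<cdot>\<^sub>m (r * (adj r * v))" if "v \<in> carrier_mat n k" for v k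
      unfolding Q_def using r ar that
      by (simp add: mult_smult_assoc_mat[of _ n n _ k] assoc_mult_mat[of _ n 1 _ n _ k])
    have Qr: "Q * r = r"
    proof -
      have "Q * r = (1 / N) \<cdot>\<^sub>m (r * (N \<cdot>\<^sub>m 1\<^sub>m 1))" using Qv[OF r] rr by simp
      also have "\<dots> = r" using r N0 by (intro eq_matI) (auto simp: scalar_prod_def)
      finally show ?thesis .
    qed
    have QQ: "Q * Q = Q"
    proof -
      have "Q * Q = (1 / N) \<cdot>\<^sub>m (Q * (r * adj r))"
        using Q r ar unfolding Q_def by (intro mult_smult_distrib) auto
      also have "Q * (r * adj r) = r * adj r" using Q r ar Qr
        by (metis assoc_mult_mat)
      finally show ?thesis by (simp add: Q_def)
    qed
    have QP: "Q * P = 0\<^sub>m n n" using Qv[OF P] arP r by auto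
    have QPv: "Q * (P * v) = 0\<^sub>m n 1" if "v \<in> carrier_mat n 1" for v
      using assoc_mult_mat[OF Q P that] QP that by simp
    have aQ: "adj Q = Q"
    proof -
      have "cnj N = N" unfolding N by simp
      moreover have "adj (r * adj r) = r * adj r" using adj_mult[OF r ar] by simp
      ultimately show ?thesis by (simp add: Q_def adj_smult)
    qed
    have PQ: "P * Q = 0\<^sub>m n n"
    proof -
      have "adj (Q * P) = P * Q" using adj_mult[OF Q P] aP aQ by simp
      moreover have "adj (Q * P) = 0\<^sub>m n n" unfolding QP by (rule eq_matI) auto
      ultimately show ?thesis by simp
    qed
    \<comment> \<open>Since \<open>P = M * X\<close>, the residual is \<open>M * x\<close>; this
      updates the factor \<open>X\<close> to some \<open>Y\<close> with
      \<open>P + Q = M * Y\<close>.\<close>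
    define x where "x = e m - X * c"
    have x: "x \<in> carrier_mat l 1" using X c e by (auto simp: x_def)
    have rx: "r = M * x"
    proof -
      have "M * x = M * e m - M * (X * c)" unfolding x_def using M X c e
        by (intro mult_minus_distrib_mat) auto
      also have "M * (X * c) = P * c" using M X c PX by (metis assoc_mult_mat)
      finally show ?thesis by (simp add: r_def c_def)
    qed
    define Y where "Y = X + (1 / N) \<cdot>\<^sub>m (x * adj r)"
    have Y: "Y \<in> carrier_mat l n" using X x ar by (auto simp: Y_def)
    have "M * Y = M * X + M * ((1 / N) \<cdot>\<^sub>m (x * adj r))" unfolding Y_def using M X x ar
      by (intro mult_add_distrib_mat) auto
    also have "M * ((1 / N) \<cdot>\<^sub>m (x * adj r)) = (1 / N) \<cdot>\<^sub>m (M * (x * adj r))" using M x ar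
      by (intro mult_smult_distrib) auto
    also have "M * (x * adj r) = r * adj r" using M x ar rx by (metis assoc_mult_mat)
    finally have PQY: "P + Q = M * Y" by (simp add: PX Q_def)
    have "(P + Q) * (P + Q) = P * (P + Q) + Q * (P + Q)"
      using P Q by (intro add_mult_distrib_mat) auto
    also have "\<dots> = (P * P + P * Q) + (Q * P + Q * Q)"
      using P Q by (simp add: mult_add_distrib_mat[of _ n n _ n])
    also have "\<dots> = P + Q" using P Q by (simp add: PP QQ PQ QP)
    finally have idem: "(P + Q) * (P + Q) = P + Q" .
    have "(P + Q) * (M * e j) = M * e j" if "j < Suc m" for j
    proof -
      have Me: "M * e j \<in> carrier_mat n 1" using M e by auto
      have split: "(P + Q) * (M * e j) = P * (M * e j) + Q * (M * e j)"
        using P Q Me by (intro add_mult_distrib_mat) auto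
      show ?thesis
      proof (cases "j = m")
        case True
        \<comment> \<open>\<open>Q\<close> kills \<open>P * c\<close> and fixes \<open>r\<close>, so
          \<open>P + Q\<close> sends \<open>c\<close> to \<open>P * c + r\<close>, which is
          \<open>c\<close>.\<close>
        have "c = r + P * c" using P c by (auto simp: r_def intro!: eq_matI)
        then have "Q * c = Q * r + Q * (P * c)" using Q r P c
          by (metis mult_add_distrib_mat mult_carrier_mat)
        also have "Q * (P * c) = 0\<^sub>m n 1" using QPv[OF c] .
        finally have "Q * c = r" using r Qr by simp
        then show ?thesis using True split P c by (auto simp: c_def[symmetric] r_def intro!: eq_matI)
      next
        case False
        then have "j < m" using that by simp
        then have "Q * (M * e j) = Q * (P * (M * e j))" using PM by simp
        also have "\<dots> = 0\<^sub>m n 1" using QPv[OF Me] .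
        finally show ?thesis using split PM[OF \<open>j < m\<close>] Me by simp
      qed
    qed
    moreover have "P + Q \<in> carrier_mat n n" using P Q by simp
    moreover have "adj (P + Q) = P + Q" using adj_add[OF P Q] aP aQ by simp
    ultimately show ?thesis using Y PQY idem by blast
  qed
qed

text \<open>\<open>supp_proj\<close> is a choice, so a witness must be found first. The Gram-Schmidt
  projection for all \<open>n\<close> columns is one: \<open>P' = J * X\<close> puts its range
  inside that of \<open>J\<close>, and \<open>P' * J = J\<close> gives the converse.\<close>

lemma supp_proj_props:
  assumes J: "J \<in> carrier_mat n n"
  defines "P \<equiv> supp_proj n J"
  shows "P \<in> carrier_mat n n" "P * P = P" "adj P = P" "P * J = J"
proof -
  define e where "e = (\<lambda>j. mat n 1 (\<lambda>(i, _). if i = j then 1 else 0) :: complex mat)"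
  obtain P' X where P': "P' \<in> carrier_mat n n" "P' * P' = P'" "adj P' = P'"
    and X: "X \<in> carrier_mat n n" and PX: "P' = J * X"
    and PJ: "\<forall>j<n. P' * (J * e j) = J * e j"
    using gram_schmidt_projection[OF J, of n] unfolding e_def by blast
  have e: "e j \<in> carrier_mat n 1" for j by (simp add: e_def)
  \<comment> \<open>Multiplication with \<open>e j\<close> extracts column \<open>j\<close>, which
    turns the statements about columns into \<open>P' * J = J\<close>.\<close>
  have ent: "(A * e j) $$ (i, 0) = A $$ (i, j)" if "A \<in> carrier_mat n n" "i < n" "j < n" for A i j
    using that by (subst mult_mat_index[OF that(1) e]) (auto simp: e_def if_distrib cong: if_cong)
  have PJJ: "P' * J = J"
  proof (rule eq_matI)
    fix i j assume "i < dim_row J" "j < dim_col J"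
    then have ij: "i < n" "j < n" using J by auto
    have "(P' * J) * e j = J * e j" using PJ ij assoc_mult_mat[OF P'(1) J e] by simp
    then show "(P' * J) $$ (i, j) = J $$ (i, j)"
      using ent[of "P' * J" i j] ent[OF J ij] P' J ij by simp
  qed (use P' J in auto)
  have "col_space n P' = col_space n J"
  proof (intro equalityI subsetI)
    fix y assume "y \<in> col_space n P'"
    then obtain v where "v \<in> carrier_vec n" "y = P' *\<^sub>v v" by (auto simp: col_space_def)
    then have "y = J *\<^sub>v (X *\<^sub>v v)" "X *\<^sub>v v \<in> carrier_vec n" using PX J X by auto
    then show "y \<in> col_space n J" by (auto simp: col_space_def)
  next
    fix y assume "y \<in> col_space n J"
    then obtain v where "v \<in> carrier_vec n" "y = J *\<^sub>v v" by (auto simp: col_space_def)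
    then have "y = P' *\<^sub>v (J *\<^sub>v v)" "J *\<^sub>v v \<in> carrier_vec n"
      using PJJ J P' by (auto simp flip: assoc_mult_mat_vec[OF P'(1) J])
    then show "y \<in> col_space n P'" by (auto simp: col_space_def)
  qed
  then have "\<exists>P. P \<in> carrier_mat n n \<and> P * P = P \<and> adj P = P \<and> col_space n P = col_space n J"
    using P' by blast
  then have *: "P \<in> carrier_mat n n \<and> P * P = P \<and> adj P = P \<and> col_space n P = col_space n J"
    unfolding P_def supp_proj_def by (rule someI_ex)
  then show P: "P \<in> carrier_mat n n" "P * P = P" "adj P = P" by auto
  show "P * J = J"
  proof (rule eq_matI)
    fix i j assume "i < dim_row J" "j < dim_col J"
    then have ij: "i < n" "j < n" using J by auto
    \<comment> \<open>The chosen projection is known only through its range: each column of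
      \<open>J\<close> has the form \<open>P *\<^sub>v w\<close> and is therefore fixed by the
      idempotent \<open>P\<close>.\<close>
    have unit: "J *\<^sub>v unit_vec n j = col J j"
      using J ij by (intro eq_vecI) auto
    have "J *\<^sub>v unit_vec n j \<in> col_space n P" using * by (auto simp: col_space_def)
    then obtain w where w: "w \<in> carrier_vec n" "col J j = P *\<^sub>v w"
      by (auto simp: col_space_def unit)
    have "col (P * J) j = P *\<^sub>v (P *\<^sub>v w)"
      using col_mult2[OF P(1) J, of j] ij w by simp
    also have "\<dots> = (P * P) *\<^sub>v w" using w P by (intro assoc_mult_mat_vec[symmetric]) auto
    also have "\<dots> = col J j" using w P by simp
    finally have "col (P * J) j $ i = col J j $ i" by simp
    then show "(P * J) $$ (i, j) = J $$ (i, j)" using P J ij by simp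
  qed (use P J in auto)
qed

subsection \<open>Positive semidefinite matrices\<close>

lemma form_eq:
  assumes "A \<in> carrier_mat n n" "v \<in> carrier_vec n"
  shows "(A *\<^sub>v v) \<bullet>c v = (\<Sum>i<n. \<Sum>j<n. A $$ (i, j) * v $ j * cnj (v $ i))"
  using assms
  by (auto simp: scalar_prod_def lessThan_atLeast0 sum_distrib_right row_def intro!: sum.cong)

lemma psd_carrier: "psd n A \<Longrightarrow> A \<in> carrier_mat n n"
  by (simp add: psd_def)

lemma psd_add:
  assumes "psd n A" "psd n B"
  shows "psd n (A + B)"
proof -
  have "((A + B) *\<^sub>v v) \<bullet>c v = (A *\<^sub>v v) \<bullet>c v + (B *\<^sub>v v) \<bullet>c v" if "v \<in> carrier_vec n" for v
    using psd_carrier[OF assms(1)] psd_carrier[OF assms(2)] that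
    by (subst (1 2 3) form_eq[of _ n]) (auto simp: distrib_right sum.distrib)
  then show ?thesis using assms by (auto simp: psd_def)
qed

lemma psd_smult:
  assumes "psd n A" "0 \<le> c"
  shows "psd n (complex_of_real c \<cdot>\<^sub>m A)"
proof -
  have "((complex_of_real c \<cdot>\<^sub>m A) *\<^sub>v v) \<bullet>c v = complex_of_real c * ((A *\<^sub>v v) \<bullet>c v)"
    if "v \<in> carrier_vec n" for v
    using psd_carrier[OF assms(1)] that
    by (subst (1 2) form_eq[of _ n]) (auto simp: sum_distrib_left mult.assoc)
  then show ?thesis using assms by (auto simp: psd_def)
qed

text \<open>The expression is the quadratic form at the sum of unit vector \<open>i\<close> and
  \<open>t\<close> times unit vector \<open>j\<close>. Suitable \<open>t\<close> extract what is
  needed about single entries, including the Hermitian symmetry that \<open>psd\<close> contains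
  only implicitly.\<close>

lemma psd_two_entries:
  assumes A: "psd n A" and ij: "i < n" "j < n"
  shows "Im (A $$ (i, i) + t * A $$ (i, j) + cnj t * A $$ (j, i) + t * cnj t * A $$ (j, j)) = 0"
    and "0 \<le> Re (A $$ (i, i) + t * A $$ (i, j) + cnj t * A $$ (j, i) + t * cnj t * A $$ (j, j))"
proof -
  \<comment> \<open>The two unit vectors are added rather than assigned by cases so that
    \<open>i = j\<close> is allowed; the facts on diagonal entries use that case.\<close>
  define v where "v = vec n (\<lambda>k. (if k = i then 1 else 0) + t * (if k = j then 1 else 0))"
  have v: "v \<in> carrier_vec n" by (simp add: v_def)
  have "(A *\<^sub>v v) \<bullet>c v = (\<Sum>k<n. \<Sum>l<n. A $$ (k, l) * v $ l * cnj (v $ k))"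
    by (rule form_eq[OF psd_carrier[OF A] v])
  also have "\<dots> = (\<Sum>k<n. (A $$ (k, i) + t * A $$ (k, j)) * cnj (v $ k))"
  proof (rule sum.cong)
    fix k assume "k \<in> {..<n}"
    have "(\<Sum>l<n. A $$ (k, l) * v $ l * cnj (v $ k)) =
      (\<Sum>l<n. (if l = i then A $$ (k, l) else 0) + (if l = j then t * A $$ (k, l) else 0)) * cnj (v $ k)"
      unfolding sum_distrib_right by (rule sum.cong) (auto simp: v_def algebra_simps)
    then show "(\<Sum>l<n. A $$ (k, l) * v $ l * cnj (v $ k)) = (A $$ (k, i) + t * A $$ (k, j)) * cnj (v $ k)"
      using ij by (simp add: sum.distrib)
  qed simp
  also have "\<dots> = (\<Sum>k<n. (if k = i then A $$ (k, i) + t * A $$ (k, j) else 0)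
                       + (if k = j then cnj t * (A $$ (k, i) + t * A $$ (k, j)) else 0))"
    by (rule sum.cong) (auto simp: v_def algebra_simps)
  also have "\<dots> = A $$ (i, i) + t * A $$ (i, j) + cnj t * A $$ (j, i) + t * cnj t * A $$ (j, j)"
    using ij by (simp add: sum.distrib algebra_simps)
  finally have "(A *\<^sub>v v) \<bullet>c v = \<dots>" .
  then show "Im (A $$ (i, i) + t * A $$ (i, j) + cnj t * A $$ (j, i) + t * cnj t * A $$ (j, j)) = 0"
    and "0 \<le> Re (A $$ (i, i) + t * A $$ (i, j) + cnj t * A $$ (j, i) + t * cnj t * A $$ (j, j))"
    using A v by (auto simp: psd_def)
qed

lemma psd_diag:
  assumes "psd n A" "i < n"
  shows "Im (A $$ (i, i)) = 0" "0 \<le> Re (A $$ (i, i))"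
  using psd_two_entries[OF assms assms(2), of 0] by simp_all

text \<open>A coarse substitute for the Cauchy-Schwarz bound. The imaginary parts at t = 1, -1, i,
  -i show that the entries at \<open>(i, j)\<close> and \<open>(j, i)\<close> are conjugate; the
  real parts then bound the real and the imaginary part of the entry by half of the right-hand side
  each.\<close>

lemma psd_entry_bound:
  assumes A: "psd n A" and ij: "i < n" "j < n"
  shows "cmod (A $$ (i, j)) \<le> Re (A $$ (i, i)) + Re (A $$ (j, j))"
proof -
  note t = psd_two_entries[OF A ij]
  have "\<bar>Re (A $$ (i, j))\<bar> \<le> (Re (A $$ (i, i)) + Re (A $$ (j, j))) / 2"
    using t[of 1] t[of "-1"] t[of \<i>] t[of "-\<i>"] by simp
  moreover have "\<bar>Im (A $$ (i, j))\<bar> \<le> (Re (A $$ (i, i)) + Re (A $$ (j, j))) / 2"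
    using t[of 1] t[of "-1"] t[of \<i>] t[of "-\<i>"] psd_diag[OF A ij(1)] psd_diag[OF A ij(2)] by simp
  ultimately show ?thesis using cmod_le[of "A $$ (i, j)"]
    by (simp add: field_simps)
qed

lemma psd_trace:
  assumes "psd n A"
  shows "Im (mtrace A) = 0" "0 \<le> Re (mtrace A)"
  using psd_diag[OF assms] psd_carrier[OF assms] by (auto simp: mtrace_eq intro!: sum_nonneg)

text \<open>Diagonal entries are nonnegative, so each is at most the trace. Both the vanishing and
  the compactness arguments rest on this.\<close>

lemma psd_entry_le_trace:
  assumes A: "psd n A" and ij: "i < n" "j < n"
  shows "cmod (A $$ (i, j)) \<le> 2 * Re (mtrace A)"
proof -
  have "Re (A $$ (k, k)) \<le> Re (mtrace A)" if "k < n" for k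
    using that psd_diag[OF A] psd_carrier[OF A]
    by (auto simp: mtrace_eq intro!: member_le_sum)
  from this[OF ij(1)] this[OF ij(2)] psd_entry_bound[OF A ij] show ?thesis by linarith
qed

lemma psd_trace_zero:
  assumes A: "psd n A" and "mtrace A = 0"
  shows "A = 0\<^sub>m n n"
  using psd_entry_le_trace[OF A] assms psd_carrier[OF A] by (intro eq_matI) auto

text \<open>The form of \<open>adj P * X * P\<close> at \<open>v\<close> is the form of
  \<open>X\<close> at \<open>P *\<^sub>v v\<close>.\<close>

lemma psd_congruence:
  assumes X: "psd n X" and P: "P \<in> carrier_mat n n"
  shows "psd n (adj P * X * P)"
proof -
  have Xc: "X \<in> carrier_mat n n" using X by (rule psd_carrier)
  have "((adj P * X * P) *\<^sub>v v) \<bullet>c v = (X *\<^sub>v (P *\<^sub>v v)) \<bullet>c (P *\<^sub>v v)" if v: "v \<in> carrier_vec n" for v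
  proof -
    define u where "u = X *\<^sub>v (P *\<^sub>v v)"
    have u: "u \<in> carrier_vec n" using Xc P v by (auto simp: u_def)
    have "(adj P * X * P) *\<^sub>v v = adj P *\<^sub>v u"
      unfolding u_def
      using assoc_mult_mat_vec[OF mult_carrier_mat[OF adj_carrier[OF P] Xc] P v]
        assoc_mult_mat_vec[OF adj_carrier[OF P] Xc, of "P *\<^sub>v v"] P v by simp
    moreover have "(adj P *\<^sub>v u) \<bullet>c v = (\<Sum>i<n. \<Sum>j<n. cnj (P $$ (j, i)) * u $ j * cnj (v $ i))"
      using P u v
      by (auto simp: scalar_prod_def lessThan_atLeast0 sum_distrib_right row_def intro!: sum.cong)
    moreover have "u \<bullet>c (P *\<^sub>v v) = (\<Sum>j<n. \<Sum>i<n. cnj (P $$ (j, i)) * u $ j * cnj (v $ i))"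
      using P u v
      by (auto simp: scalar_prod_def lessThan_atLeast0 sum_distrib_left row_def mult.commute
            mult.left_commute intro!: sum.cong)
    ultimately show ?thesis unfolding u_def by (subst (asm) sum.swap) simp
  qed
  then show ?thesis using X P Xc by (auto simp: psd_def)
qed

section \<open>Traces of products with a projection\<close>

lemma trace_proj_mult:
  assumes P: "P \<in> carrier_mat n n" "P * P = P" and X: "X \<in> carrier_mat n n"
  shows "mtrace (P * X) = mtrace (P * X * P)"
proof -
  have "mtrace (P * X * P) = mtrace (P * (P * X))"
    using P X by (intro mtrace_comm) auto
  also have "P * (P * X) = P * X" using assoc_mult_mat[OF P(1) P(1) X] P by simp
  finally show ?thesis by simp
qed

text \<open>The trace is that of the compression \<open>P * X * P\<close>, which is positive
  semidefinite. With \<open>X\<close> the slack \<open>\<rho> \<otimes> 1 - W\<close>, this makes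
  every value of the program for \<open>DNS\<close> nonpositive.\<close>

lemma trace_proj_psd:
  assumes P: "P \<in> carrier_mat n n" "P * P = P" "adj P = P" and X: "psd n X"
  shows "Im (mtrace (P * X)) = 0" "0 \<le> Re (mtrace (P * X))"
proof -
  have "psd n (P * X * P)" using psd_congruence[OF X P(1)] P by simp
  then show "Im (mtrace (P * X)) = 0" "0 \<le> Re (mtrace (P * X))"
    using psd_trace trace_proj_mult[OF P(1,2) psd_carrier[OF X]] by auto
qed

text \<open>Trace zero forces the positive semidefinite \<open>P * X * P\<close> to vanish, and
  \<open>P * J = J\<close> with its adjoint \<open>J * P = J\<close> lets \<open>P\<close> be
  inserted on both sides of \<open>X\<close> under the trace. For the Choi matrix \<open>J\<close>
  this carries the constraint on \<open>P\<close> over to the channel.\<close>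

lemma trace_zero_of_proj:
  assumes P: "P \<in> carrier_mat n n" "P * P = P" "adj P = P" and X: "psd n X"
    and J: "J \<in> carrier_mat n n" "adj J = J" "P * J = J"
    and zero: "mtrace (P * X) = 0"
  shows "mtrace (J * X) = 0"
proof -
  have Xc: "X \<in> carrier_mat n n" using X by (rule psd_carrier)
  have "psd n (P * X * P)" using psd_congruence[OF X P(1)] P by simp
  then have PXP: "P * X * P = 0\<^sub>m n n"
    using psd_trace_zero zero trace_proj_mult[OF P(1,2) Xc] by simp
  have JP: "J * P = J" using adj_mult[OF P(1) J(1)] P J by simp
  have "mtrace (J * X) = mtrace (P * (J * X))"
    using assoc_mult_mat[OF P(1) J(1) Xc] J by simp
  also have "\<dots> = mtrace (J * X * P)" using P J Xc by (intro mtrace_comm) auto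
  also have "J * X * P = J * (P * X * P)"
  proof -
    have "J * X * P = (J * P) * (X * P)" using J Xc P assoc_mult_mat[OF J(1) Xc P(1)] JP by simp
    also have "\<dots> = J * (P * X * P)"
      using assoc_mult_mat[OF J(1) P(1), of "X * P" n] assoc_mult_mat[OF P(1) Xc P(1)] Xc P by simp
    finally show ?thesis .
  qed
  finally show ?thesis using PXP J by (simp add: mtrace_def)
qed

text \<open>Crude, but the bound depends on \<open>U\<close> only through its trace, which
  feasibility fixes.\<close>

lemma trace_mult_bound:
  assumes U: "psd n U" and J: "J \<in> carrier_mat n n"
  shows "cmod (mtrace (J * U)) \<le> (\<Sum>i<n. \<Sum>j<n. cmod (J $$ (i, j))) * (2 * Re (mtrace U))"
proof -
  have Uc: "U \<in> carrier_mat n n" using U by (rule psd_carrier)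
  have "mtrace (J * U) = (\<Sum>i<n. \<Sum>j<n. J $$ (i, j) * U $$ (j, i))"
    using J Uc by (simp add: mtrace_eq[of _ n n] mult_mat_index[of J n n U n] del: index_mult_mat)
  also have "cmod \<dots> \<le> (\<Sum>i<n. \<Sum>j<n. cmod (J $$ (i, j)) * (2 * Re (mtrace U)))"
    by (intro sum_norm_le) (auto simp: norm_mult intro!: mult_left_mono psd_entry_le_trace[OF U])
  finally show ?thesis by (simp add: sum_distrib_right)
qed

subsection \<open>The operators \<open>S \<otimes> 1\<close> and the partial trace\<close>

lemma index_less_prod: "a < dA \<Longrightarrow> b < dB \<Longrightarrow> a * dB + b < dA * (dB::nat)"
  by (metis div_less_iff_less_mult div_mult_self3 add.commute div_less add.right_neutral
        gr_implies_not0 neq0_conv)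

lemma sum_prod_index: "(\<Sum>i<dA * dB. f i) = (\<Sum>a<dA. \<Sum>b<dB::nat. f (a * dB + b))"
proof (induction dA)
  case (Suc dA)
  \<comment> \<open>The length of the last block is generalized to \<open>m\<close> for the
    induction, because \<open>dB\<close> also occurs in \<open>dA * dB\<close>.\<close>
  have "(\<Sum>i<dA * dB + m. f i) = (\<Sum>i<dA * dB. f i) + (\<Sum>b<m. f (dA * dB + b))" for m
    by (induction m) (auto simp: add.assoc)
  from this[of dB] Suc show ?case by (simp add: add.commute)
qed simp

lemma tensor_one_carrier [simp]: "S \<in> carrier_mat dA dA \<Longrightarrow> tensor S (1\<^sub>m dB) \<in> carrier_mat (dA * dB) (dA * dB)"
  by (auto simp: tensor_def)

lemma tensor_one_index:
  "S \<in> carrier_mat dA dA \<Longrightarrow> a < dA \<Longrightarrow> a' < dA \<Longrightarrow> b < dB \<Longrightarrow> b' < dB \<Longrightarrow>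
   tensor S (1\<^sub>m dB) $$ (a * dB + b, a' * dB + b') = (if b = b' then S $$ (a, a') else 0)"
  by (auto simp: tensor_def index_less_prod)

lemma tensor_one_smult:
  "S \<in> carrier_mat dA dA \<Longrightarrow> tensor (c \<cdot>\<^sub>m S) (1\<^sub>m dB) = c \<cdot>\<^sub>m tensor S (1\<^sub>m dB)"
  by (rule eq_matI)
     (auto simp: tensor_def less_mult_imp_div_less)

lemma mtrace_ptrace:
  "U \<in> carrier_mat (dA * dB) (dA * dB) \<Longrightarrow> mtrace (ptrace_A dA dB U) = mtrace U"
  by (simp add: mtrace_eq[of U "dA * dB" "dA * dB"] sum_prod_index)
     (simp add: mtrace_def ptrace_A_def sum.swap[of _ "{..<dB}"])

subsection \<open>Choi matrices of channels\<close>

lemma ketbra_carrier: "ketbra d i j \<in> carrier_mat d d"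
  by (simp add: ketbra_def)

text \<open>Each term \<open>F * ketbra dA i j * adj F\<close> is the outer product of column
  \<open>i\<close> with column \<open>j\<close> of \<open>F\<close>.\<close>

lemma kraus_ketbra_index:
  assumes E: "\<And>k. k < length Es \<Longrightarrow> Es ! k \<in> carrier_mat dB dA"
    and "i < dA" "j < dA" "b < dB" "b' < dB"
  shows "kraus_apply dB Es (ketbra dA i j) $$ (b, b') =
         (\<Sum>k<length Es. Es ! k $$ (b, i) * cnj (Es ! k $$ (b', j)))"
proof -
  have "(F * ketbra dA i j * adj F) $$ (b, b') = F $$ (b, i) * cnj (F $$ (b', j))"
    if F: "F \<in> carrier_mat dB dA" for F
  proof -
    have FK: "(F * ketbra dA i j) $$ (b, q) = (if q = j then F $$ (b, i) else 0)" if "q < dA" for q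
    proof -
      have "(F * ketbra dA i j) $$ (b, q) = (\<Sum>p<dA. F $$ (b, p) * ketbra dA i j $$ (p, q))"
        using mult_mat_index[OF F ketbra_carrier] that assms by simp
      also have "\<dots> = (\<Sum>p<dA. if p = i then (if q = j then F $$ (b, p) else 0) else 0)"
        using that by (intro sum.cong) (auto simp: ketbra_def)
      finally show ?thesis using assms by simp
    qed
    have "(F * ketbra dA i j * adj F) $$ (b, b') =
        (\<Sum>q<dA. (F * ketbra dA i j) $$ (b, q) * adj F $$ (q, b'))"
      using mult_mat_index[OF mult_carrier_mat[OF F ketbra_carrier] adj_carrier[OF F]] assms by simp
    also have "\<dots> = (\<Sum>q<dA. if q = j then F $$ (b, i) * adj F $$ (q, b') else 0)"
      by (intro sum.cong) (simp_all add: FK del: index_mult_mat)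
    finally show ?thesis using F assms by simp
  qed
  then show ?thesis using assms by (simp add: kraus_apply_def msum_def del: index_mult_mat)
qed

lemma choi_carrier: "choi dA dB Es \<in> carrier_mat (dA * dB) (dA * dB)"
  by (simp add: choi_def msum_def)

lemma choi_index:
  assumes E: "\<And>k. k < length Es \<Longrightarrow> Es ! k \<in> carrier_mat dB dA"
    and a: "a < dA" "a' < dA" and b: "b < dB" "b' < dB"
  shows "choi dA dB Es $$ (a * dB + b, a' * dB + b') =
         (\<Sum>k<length Es. Es ! k $$ (b, a) * cnj (Es ! k $$ (b', a')))"
proof -
  let ?N = "\<lambda>i j. kraus_apply dB Es (ketbra dA i j)"
  have N: "dim_row (?N i j) = dB" "dim_col (?N i j) = dB" for i j
    by (simp_all add: kraus_apply_def msum_def)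
  have "choi dA dB Es $$ (a * dB + b, a' * dB + b') =
      (\<Sum>(i, j)\<in>{..<dA} \<times> {..<dA}. tensor (ketbra dA i j) (?N i j) $$ (a * dB + b, a' * dB + b'))"
    using a b by (simp add: choi_def msum_def index_less_prod case_prod_unfold)
  \<comment> \<open>Only the pair \<open>(a, a')\<close> contributes, as
    \<open>ketbra dA i j\<close> has a single nonzero entry.\<close>
  also have "\<dots> = (\<Sum>p\<in>{..<dA} \<times> {..<dA}. if p = (a, a') then ?N a a' $$ (b, b') else 0)"
  proof (intro sum.cong refl, clarify)
    fix i j
    have "tensor (ketbra dA i j) (?N i j) $$ (a * dB + b, a' * dB + b') =
        ketbra dA i j $$ (a, a') * ?N i j $$ (b, b')"
      using a b ketbra_carrier[of dA i j] by (simp add: tensor_def N index_less_prod)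
    also have "\<dots> = (if (i, j) = (a, a') then ?N a a' $$ (b, b') else 0)"
      using a by (simp add: ketbra_def)
    finally show "tensor (ketbra dA i j) (?N i j) $$ (a * dB + b, a' * dB + b') =
        (if (i, j) = (a, a') then ?N a a' $$ (b, b') else 0)" .
  qed
  also have "\<dots> = ?N a a' $$ (b, b')" using a by simp
  finally show ?thesis using kraus_ketbra_index[OF E a b] by simp
qed

text \<open>Exchanging the two indices conjugates the entry formula
  \<open>choi_index\<close>.\<close>

lemma adj_choi:
  assumes E: "\<And>k. k < length Es \<Longrightarrow> Es ! k \<in> carrier_mat dB dA"
  shows "adj (choi dA dB Es) = choi dA dB Es"
proof (rule eq_matI)
  fix i j assume "i < dim_row (choi dA dB Es)" "j < dim_col (choi dA dB Es)"
  then have ij: "i < dA * dB" "j < dA * dB" using choi_carrier[of dA dB Es] by auto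
  have i: "i = i div dB * dB + i mod dB" "i div dB < dA" "i mod dB < dB"
    and j: "j = j div dB * dB + j mod dB" "j div dB < dA" "j mod dB < dB"
    using ij by (auto simp: less_mult_imp_div_less intro!: mod_less_divisor gr0I)
  have "cnj (choi dA dB Es $$ (j div dB * dB + j mod dB, i div dB * dB + i mod dB)) =
      choi dA dB Es $$ (i div dB * dB + i mod dB, j div dB * dB + j mod dB)"
    using choi_index[OF E j(2) i(2) j(3) i(3)] choi_index[OF E i(2) j(2) i(3) j(3)]
    by (simp add: mult.commute)
  then show "adj (choi dA dB Es) $$ (i, j) = choi dA dB Es $$ (i, j)"
    using ij i(1) j(1) choi_carrier[of dA dB Es] by simp
qed (use choi_carrier[of dA dB Es] in auto)

lemma channel_kraus:
  assumes "is_channel dA dB Es" "k < length Es"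
  shows "Es ! k \<in> carrier_mat dB dA"
  using assms by (auto simp: is_channel_def)

text \<open>This is the \<open>(a', a)\<close> entry of the Kraus completeness relation, written the
  way \<open>choi_index\<close> produces it: the partial trace of the Choi matrix over B is the
  identity on A.\<close>

lemma channel_trace_preserving:
  assumes ch: "is_channel dA dB Es" and a: "a < dA" "a' < dA"
  shows "(\<Sum>b<dB. \<Sum>k<length Es. Es ! k $$ (b, a) * cnj (Es ! k $$ (b, a'))) = (if a = a' then 1 else 0)"
proof -
  have "msum dA dA (\<lambda>k. adj (Es ! k) * Es ! k) {..<length Es} = 1\<^sub>m dA"
    using ch by (simp add: is_channel_def)
  then have "(1\<^sub>m dA) $$ (a', a) = msum dA dA (\<lambda>k. adj (Es ! k) * Es ! k) {..<length Es} $$ (a', a)"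
    by simp
  also have "\<dots> = (\<Sum>k<length Es. (adj (Es ! k) * Es ! k) $$ (a', a))"
    using a by (simp add: msum_def)
  also have "\<dots> = (\<Sum>k<length Es. \<Sum>b<dB. adj (Es ! k) $$ (a', b) * Es ! k $$ (b, a))"
    using mult_mat_index[OF adj_carrier[OF channel_kraus[OF ch]] channel_kraus[OF ch]] a
    by (intro sum.cong) auto
  also have "\<dots> = (\<Sum>k<length Es. \<Sum>b<dB. Es ! k $$ (b, a) * cnj (Es ! k $$ (b, a')))"
  proof (intro sum.cong refl)
    fix k b assume "k \<in> {..<length Es}" "b \<in> {..<dB}"
    then show "adj (Es ! k) $$ (a', b) * Es ! k $$ (b, a) = Es ! k $$ (b, a) * cnj (Es ! k $$ (b, a'))"
      using channel_kraus[OF ch, of k] a by simp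
  qed
  finally show ?thesis using a by (subst sum.swap) auto
qed

lemma channel_dims:
  assumes ch: "is_channel dA dB Es"
  shows "0 < dA" "0 < dB"
proof -
  show "0 < dA" using ch by (simp add: is_channel_def)
  \<comment> \<open>With \<open>dB = 0\<close> the sum over \<open>b\<close> would be empty, yet it
    has to equal 1.\<close>
  with channel_trace_preserving[OF ch, of 0 0] show "0 < dB" by (cases dB) auto
qed

text \<open>The identity on B leaves only \<open>b' = b\<close>, and summing over \<open>b\<close>
  replaces the Choi matrix by its partial trace over B, the identity on A.\<close>

lemma trace_choi_tensor:
  assumes ch: "is_channel dA dB Es" and S: "S \<in> carrier_mat dA dA"
  shows "mtrace (choi dA dB Es * tensor S (1\<^sub>m dB)) = mtrace S"
proof -
  let ?J = "choi dA dB Es" and ?T = "tensor S (1\<^sub>m dB)"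
  have "mtrace (?J * ?T) = (\<Sum>i<dA * dB. (?J * ?T) $$ (i, i))"
    by (rule mtrace_eq[OF mult_carrier_mat[OF choi_carrier tensor_one_carrier[OF S]]])
  also have "\<dots> = (\<Sum>i<dA * dB. \<Sum>j<dA * dB. ?J $$ (i, j) * ?T $$ (j, i))"
    using mult_mat_index[OF choi_carrier tensor_one_carrier[OF S]] by (intro sum.cong) auto
  also have "\<dots> = (\<Sum>a<dA. \<Sum>b<dB. \<Sum>a'<dA. \<Sum>b'<dB.
      ?J $$ (a * dB + b, a' * dB + b') * ?T $$ (a' * dB + b', a * dB + b))"
    by (simp only: sum_prod_index)
  also have "\<dots> = (\<Sum>a<dA. \<Sum>b<dB. \<Sum>a'<dA. ?J $$ (a * dB + b, a' * dB + b) * S $$ (a', a))"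
  proof (intro sum.cong refl)
    fix a b a' assume "a \<in> {..<dA}" "b \<in> {..<dB}" "a' \<in> {..<dA}"
    then have "(\<Sum>b'<dB. ?J $$ (a * dB + b, a' * dB + b') * ?T $$ (a' * dB + b', a * dB + b)) =
        (\<Sum>b'<dB. if b' = b then ?J $$ (a * dB + b, a' * dB + b') * S $$ (a', a) else 0)"
      using S by (intro sum.cong) (auto simp: tensor_one_index)
    then show "(\<Sum>b'<dB. ?J $$ (a * dB + b, a' * dB + b') * ?T $$ (a' * dB + b', a * dB + b)) =
        ?J $$ (a * dB + b, a' * dB + b) * S $$ (a', a)" using \<open>b \<in> _\<close> by simp
  qed
  also have "\<dots> = (\<Sum>a<dA. \<Sum>a'<dA. (\<Sum>b<dB. ?J $$ (a * dB + b, a' * dB + b)) * S $$ (a', a))"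
    by (subst sum.swap) (simp add: sum_distrib_right)
  also have "\<dots> = (\<Sum>a<dA. \<Sum>a'<dA. if a' = a then S $$ (a', a) else 0)"
  proof (intro sum.cong refl)
    fix a a' assume a: "a \<in> {..<dA}" "a' \<in> {..<dA}"
    then have "(\<Sum>b<dB. ?J $$ (a * dB + b, a' * dB + b)) =
        (\<Sum>b<dB. \<Sum>k<length Es. Es ! k $$ (b, a) * cnj (Es ! k $$ (b, a')))"
      by (intro sum.cong choi_index channel_kraus[OF ch]) auto
    then show "(\<Sum>b<dB. ?J $$ (a * dB + b, a' * dB + b)) * S $$ (a', a) =
        (if a' = a then S $$ (a', a) else 0)"
      using channel_trace_preserving[OF ch, of a a'] a by auto
  qed
  also have "\<dots> = mtrace S" using S by (simp add: mtrace_eq)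
  finally show ?thesis .
qed

subsection \<open>Entrywise limits of matrices\<close>

text \<open>Bolzano-Weierstrass is applied one coordinate at a time; coordinates treated earlier
  keep converging along a further subsequence.\<close>

lemma common_convergent_subsequence:
  fixes x :: "'i \<Rightarrow> nat \<Rightarrow> complex"
  assumes "finite I" "\<And>i n. i \<in> I \<Longrightarrow> cmod (x i n) \<le> C"
  shows "\<exists>r. strict_mono r \<and> (\<forall>i\<in>I. convergent (\<lambda>n. x i (r n)))"
  using assms
proof (induction I rule: finite_induct)
  case empty
  show ?case by (intro exI[of _ id]) (auto simp: strict_mono_def)
next
  case (insert i I)
  then obtain r where r: "strict_mono r" "\<forall>i\<in>I. convergent (\<lambda>n. x i (r n))" by auto
  have "\<forall>n. cmod (x i (r n)) \<le> C" using insert.prems by simp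
  from Bolzano_Weierstrass_complex_disc[OF this] obtain s z where s: "strict_mono (s :: nat \<Rightarrow> nat)"
    and z: "\<forall>e>0. \<exists>N. \<forall>n\<ge>N. cmod (x i (r (s n)) - z) < e" by blast
  have "(\<lambda>n. x i (r (s n))) \<longlonglongrightarrow> z" using z by (intro LIMSEQ_I) auto
  moreover have "convergent (\<lambda>n. x j (r (s n)))" if "j \<in> I" for j
    using convergent_subseq_convergent[OF _ s, of "\<lambda>n. x j (r n)"] r that by (simp add: o_def)
  ultimately have "\<forall>j\<in>insert i I. convergent (\<lambda>n. x j ((r \<circ> s) n))"
    by (auto simp: convergent_def)
  with strict_mono_o[OF r(1) s] show ?case by blast
qed

text \<open>The dimensions are recorded because the type \<open>complex mat\<close> contains
  matrices of all sizes.\<close>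

definition mat_tendsto :: "nat \<Rightarrow> nat \<Rightarrow> (nat \<Rightarrow> complex mat) \<Rightarrow> complex mat \<Rightarrow> bool" where
  "mat_tendsto nr nc X L \<longleftrightarrow> (\<forall>k. X k \<in> carrier_mat nr nc) \<and> L \<in> carrier_mat nr nc \<and>
     (\<forall>i<nr. \<forall>j<nc. (\<lambda>k. X k $$ (i, j)) \<longlonglongrightarrow> L $$ (i, j))"

lemma mat_tendstoD:
  assumes "mat_tendsto nr nc X L"
  shows "X k \<in> carrier_mat nr nc" "L \<in> carrier_mat nr nc"
    "i < nr \<Longrightarrow> j < nc \<Longrightarrow> (\<lambda>k. X k $$ (i, j)) \<longlonglongrightarrow> L $$ (i, j)"
  using assms by (auto simp: mat_tendsto_def)

lemma mat_tendsto_const: "L \<in> carrier_mat nr nc \<Longrightarrow> mat_tendsto nr nc (\<lambda>k. L) L"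
  by (simp add: mat_tendsto_def)

lemma mat_tendsto_const_unique:
  assumes "mat_tendsto nr nc X L" "\<And>k. X k = M"
  shows "L = M"
proof -
  note D = mat_tendstoD[OF assms(1)]
  have "M \<in> carrier_mat nr nc" using D(1) assms(2) by metis
  moreover have "L $$ (i, j) = M $$ (i, j)" if "i < nr" "j < nc" for i j
    using D(3)[OF that] assms(2) by (simp add: LIMSEQ_const_iff)
  ultimately show ?thesis using D(2) by (intro eq_matI) auto
qed

lemma mat_tendsto_minus:
  assumes "mat_tendsto nr nc X L" "mat_tendsto nr nc Y M"
  shows "mat_tendsto nr nc (\<lambda>k. X k - Y k) (L - M)"
proof -
  have "(\<lambda>k. (X k - Y k) $$ (i, j)) \<longlonglongrightarrow> (L - M) $$ (i, j)" if ij: "i < nr" "j < nc" for i j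
  proof -
    have "(X k - Y k) $$ (i, j) = X k $$ (i, j) - Y k $$ (i, j)" for k
      using mat_tendstoD(1)[OF assms(2), of k] ij by simp
    moreover have "(L - M) $$ (i, j) = L $$ (i, j) - M $$ (i, j)"
      using mat_tendstoD(2)[OF assms(2)] ij by simp
    ultimately show ?thesis
      using tendsto_diff[OF mat_tendstoD(3)[OF assms(1) ij] mat_tendstoD(3)[OF assms(2) ij]] by simp
  qed
  then show ?thesis using assms by (simp add: mat_tendsto_def minus_carrier_mat)
qed

lemma mat_tendsto_mult:
  assumes "mat_tendsto nr m X L" "mat_tendsto m nc Y M"
  shows "mat_tendsto nr nc (\<lambda>k. X k * Y k) (L * M)"
proof -
  note X = mat_tendstoD[OF assms(1)] and Y = mat_tendstoD[OF assms(2)]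
  have "(\<lambda>k. (X k * Y k) $$ (i, j)) \<longlonglongrightarrow> (L * M) $$ (i, j)" if ij: "i < nr" "j < nc" for i j
    unfolding mult_mat_index[OF X(1) Y(1) ij] mult_mat_index[OF X(2) Y(2) ij]
    using ij by (intro tendsto_sum tendsto_mult X(3) Y(3)) auto
  moreover have "X k * Y k \<in> carrier_mat nr nc" "L * M \<in> carrier_mat nr nc" for k
    by (rule mult_carrier_mat[OF X(1) Y(1)], rule mult_carrier_mat[OF X(2) Y(2)])
  ultimately show ?thesis by (simp add: mat_tendsto_def del: index_mult_mat)
qed

lemma mat_tendsto_tensor_one:
  assumes "mat_tendsto dA dA X L"
  shows "mat_tendsto (dA * dB) (dA * dB) (\<lambda>k. tensor (X k) (1\<^sub>m dB)) (tensor L (1\<^sub>m dB))"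
proof -
  note X = mat_tendstoD[OF assms(1)]
  have dims: "dim_row (X k) = dA" "dim_col (X k) = dA" "dim_row L = dA" "dim_col L = dA" for k
    using X(1)[of k] X(2) by auto
  have "(\<lambda>k. tensor (X k) (1\<^sub>m dB) $$ (i, j)) \<longlonglongrightarrow> tensor L (1\<^sub>m dB) $$ (i, j)"
    if ij: "i < dA * dB" "j < dA * dB" for i j
    using ij by (auto simp: tensor_def dims less_mult_imp_div_less intro!: tendsto_mult X(3))
  then show ?thesis using X(1,2) by (simp add: mat_tendsto_def)
qed

lemma mat_tendsto_ptrace:
  assumes "mat_tendsto (dA * dB) (dA * dB) X L"
  shows "mat_tendsto dB dB (\<lambda>k. ptrace_A dA dB (X k)) (ptrace_A dA dB L)"
  unfolding mat_tendsto_def ptrace_A_def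
  by (auto intro!: tendsto_sum mat_tendstoD(3)[OF assms] index_less_prod)

lemma tendsto_mtrace:
  assumes "mat_tendsto n n X L"
  shows "(\<lambda>k. mtrace (X k)) \<longlonglongrightarrow> mtrace L"
  unfolding mtrace_eq[OF mat_tendstoD(1)[OF assms]] mtrace_eq[OF mat_tendstoD(2)[OF assms]]
  by (intro tendsto_sum mat_tendstoD(3)[OF assms]) auto

text \<open>For fixed \<open>v\<close> the quadratic form is a finite sum in the entries, so it
  converges, and both conditions on it are closed.\<close>

lemma psd_limit:
  assumes X: "mat_tendsto n n X L" and psd: "\<And>k. psd n (X k)"
  shows "psd n L"
  unfolding psd_def
proof (intro conjI ballI)
  note D = mat_tendstoD[OF X]
  show "L \<in> carrier_mat n n" by (rule D(2))
  fix v :: "complex vec" assume v: "v \<in> carrier_vec n"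
  have lim: "(\<lambda>k. (X k *\<^sub>v v) \<bullet>c v) \<longlonglongrightarrow> (L *\<^sub>v v) \<bullet>c v"
    unfolding form_eq[OF D(1) v] form_eq[OF D(2) v]
    by (intro tendsto_sum tendsto_mult D(3) tendsto_const) auto
  show "Im ((L *\<^sub>v v) \<bullet>c v) = 0"
    using tendsto_Im[OF lim] psd v by (simp add: psd_def LIMSEQ_const_iff)
  show "0 \<le> Re ((L *\<^sub>v v) \<bullet>c v)"
    by (rule LIMSEQ_le_const[OF tendsto_Re[OF lim]]) (use psd v in \<open>auto simp: psd_def\<close>)
qed

subsection \<open>Attainment of the maximum\<close>

text \<open>Feasibility is kept as a property of pairs rather than of trace values, so that limits
  of pairs can be taken.\<close>

definition ups_feasible :: "nat \<Rightarrow> nat \<Rightarrow> complex mat \<Rightarrow> complex mat \<Rightarrow> complex mat \<Rightarrow> bool" where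
  "ups_feasible dA dB P S U \<longleftrightarrow>
     S \<in> carrier_mat dA dA \<and> U \<in> carrier_mat (dA * dB) (dA * dB) \<and> psd (dA * dB) U \<and>
     psd (dA * dB) (tensor S (1\<^sub>m dB) - U) \<and> ptrace_A dA dB U = 1\<^sub>m dB \<and>
     mtrace (P * (tensor S (1\<^sub>m dB) - U)) = 0"

lemma Ups_vals_eq:
  "Ups_vals dA dB Es = {Re (mtrace S) | S U. ups_feasible dA dB (P_AB dA dB Es) S U}"
  unfolding Ups_vals_def ups_feasible_def loewner_le_def
  by (intro arg_cong[where f = Collect] ext) (use tensor_one_carrier in blast)

lemma mtrace_minus:
  "A \<in> carrier_mat n n \<Longrightarrow> B \<in> carrier_mat n n \<Longrightarrow> mtrace (A - B) = mtrace A - mtrace B"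
  by (auto simp: mtrace_def sum_subtractf)

lemma mtrace_tensor_one:
  assumes "S \<in> carrier_mat dA dA"
  shows "mtrace (tensor S (1\<^sub>m dB)) = of_nat dB * mtrace S"
proof -
  have "mtrace (tensor S (1\<^sub>m dB)) = (\<Sum>a<dA. \<Sum>b<dB. S $$ (a, a))"
    using assms unfolding mtrace_eq[OF tensor_one_carrier[OF assms]] sum_prod_index
    by (intro sum.cong) (auto simp: tensor_one_index)
  then show ?thesis using assms by (simp add: mtrace_eq sum_distrib_left)
qed

lemma psd_of_loewner:
  assumes "psd n U" "psd n (T - U)" "T \<in> carrier_mat n n"
  shows "psd n T"
proof -
  have "(T - U) + U = T" using psd_carrier[OF assms(1)] assms(3) by (intro eq_matI) auto
  then show ?thesis using psd_add[OF assms(2,1)] by simp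
qed

text \<open>The partial trace condition fixes the trace of \<open>U\<close>; comparing it with the
  trace of \<open>S \<otimes> 1\<close>, which is \<open>dB\<close> times that of \<open>S\<close>,
  gives the lower bound. Positivity is available for \<open>S \<otimes> 1\<close>, and the reality
  of the trace of \<open>S\<close> is derived from it.\<close>

lemma ups_feasible_trace:
  assumes f: "ups_feasible dA dB P S U" and dB: "0 < dB"
  shows "mtrace U = of_nat dB" "Im (mtrace S) = 0" "1 \<le> Re (mtrace S)"
    and "psd (dA * dB) (tensor S (1\<^sub>m dB))"
proof -
  have S: "S \<in> carrier_mat dA dA" and U: "psd (dA * dB) U"
    and TU: "psd (dA * dB) (tensor S (1\<^sub>m dB) - U)" and pt: "ptrace_A dA dB U = 1\<^sub>m dB"
    using f by (auto simp: ups_feasible_def)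
  show T: "psd (dA * dB) (tensor S (1\<^sub>m dB))"
    by (rule psd_of_loewner[OF U TU tensor_one_carrier[OF S]])
  show trU: "mtrace U = of_nat dB"
    using mtrace_ptrace[OF psd_carrier[OF U]] pt by (simp add: mtrace_def)
  show "Im (mtrace S) = 0" using psd_trace(1)[OF T] mtrace_tensor_one[OF S, of dB] dB by simp
  have "0 \<le> Re (mtrace (tensor S (1\<^sub>m dB) - U))" by (rule psd_trace(2)[OF TU])
  then have "real dB * 1 \<le> real dB * Re (mtrace S)"
    using mtrace_minus[OF psd_carrier[OF T] psd_carrier[OF U]] trU mtrace_tensor_one[OF S, of dB]
    by simp
  then show "1 \<le> Re (mtrace S)" using dB by (simp only: mult_le_cancel_left_pos of_nat_0_less_iff)
qed

lemma P_AB_props: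
  assumes "is_channel dA dB Es"
  shows "P_AB dA dB Es \<in> carrier_mat (dA * dB) (dA * dB)"
    "P_AB dA dB Es * P_AB dA dB Es = P_AB dA dB Es" "adj (P_AB dA dB Es) = P_AB dA dB Es"
    "P_AB dA dB Es * choi dA dB Es = choi dA dB Es"
  using supp_proj_props[OF choi_carrier, of dA dB Es] by (simp_all add: P_AB_def)

lemma ups_feasible_bounded:
  assumes ch: "is_channel dA dB Es" and f: "ups_feasible dA dB (P_AB dA dB Es) S U"
  shows "Re (mtrace S) \<le> (\<Sum>i<dA * dB. \<Sum>j<dA * dB. cmod (choi dA dB Es $$ (i, j))) * (2 * dB)"
proof -
  let ?J = "choi dA dB Es" and ?T = "tensor S (1\<^sub>m dB)"
  note P = P_AB_props[OF ch] and tr = ups_feasible_trace[OF f channel_dims(2)[OF ch]]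
  have S: "S \<in> carrier_mat dA dA" and U: "psd (dA * dB) U" and TU: "psd (dA * dB) (?T - U)"
    and zero: "mtrace (P_AB dA dB Es * (?T - U)) = 0"
    using f by (auto simp: ups_feasible_def)
  note J = choi_carrier[of dA dB Es] and Uc = psd_carrier[OF U] and Tc = tensor_one_carrier[OF S, of dB]
  \<comment> \<open>The slack now has trace zero against the Choi matrix itself, so
    \<open>S \<otimes> 1\<close> can be traded for \<open>U\<close>, whose trace is
    \<open>dB\<close>.\<close>
  have "mtrace (?J * (?T - U)) = 0"
    by (rule trace_zero_of_proj[OF P(1-3) TU J adj_choi P(4) zero]) (rule channel_kraus[OF ch])
  moreover have "?J * (?T - U) = ?J * ?T - ?J * U"
    by (rule mult_minus_distrib_mat[OF J Tc Uc])
  ultimately have "mtrace (?J * ?T) = mtrace (?J * U)"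
    using mtrace_minus[OF mult_carrier_mat[OF J Tc] mult_carrier_mat[OF J Uc]] by simp
  then have "mtrace S = mtrace (?J * U)" by (simp add: trace_choi_tensor[OF ch S])
  then have "Re (mtrace S) \<le> cmod (mtrace (?J * U))" by (simp add: complex_Re_le_cmod)
  with trace_mult_bound[OF U J] tr(1) show ?thesis by simp
qed

text \<open>All constraints are closed: two positivity conditions and two equations between
  continuous functions of the entries.\<close>

lemma ups_feasible_limit:
  assumes S: "mat_tendsto dA dA SS S" and U: "mat_tendsto (dA * dB) (dA * dB) UU U"
    and P: "P \<in> carrier_mat (dA * dB) (dA * dB)" and f: "\<And>k. ups_feasible dA dB P (SS k) (UU k)"
  shows "ups_feasible dA dB P S U"
proof -
  note TU = mat_tendsto_minus[OF mat_tendsto_tensor_one[OF S] U]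
  have "psd (dA * dB) U" by (rule psd_limit[OF U]) (use f in \<open>simp add: ups_feasible_def\<close>)
  moreover have "psd (dA * dB) (tensor S (1\<^sub>m dB) - U)"
    by (rule psd_limit[OF TU]) (use f in \<open>simp add: ups_feasible_def\<close>)
  moreover have "ptrace_A dA dB U = 1\<^sub>m dB"
    by (rule mat_tendsto_const_unique[OF mat_tendsto_ptrace[OF U]]) (use f in \<open>simp add: ups_feasible_def\<close>)
  moreover have "mtrace (P * (tensor S (1\<^sub>m dB) - U)) = 0"
    using tendsto_mtrace[OF mat_tendsto_mult[OF mat_tendsto_const[OF P] TU]] f
    by (simp add: ups_feasible_def LIMSEQ_const_iff)
  ultimately show ?thesis using mat_tendstoD(2)[OF S] mat_tendstoD(2)[OF U]
    by (simp add: ups_feasible_def)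
qed

lemma convergent_mat_subsequences:
  fixes X Y :: "nat \<Rightarrow> complex mat"
  assumes X: "\<And>k. X k \<in> carrier_mat n n" "\<And>k i j. i < n \<Longrightarrow> j < n \<Longrightarrow> cmod (X k $$ (i, j)) \<le> C"
    and Y: "\<And>k. Y k \<in> carrier_mat m m" "\<And>k i j. i < m \<Longrightarrow> j < m \<Longrightarrow> cmod (Y k $$ (i, j)) \<le> C"
  obtains r L M where "strict_mono r" "mat_tendsto n n (\<lambda>k. X (r k)) L" "mat_tendsto m m (\<lambda>k. Y (r k)) M"
proof -
  \<comment> \<open>The entries of both sequences are joined in one finite index set, a disjoint
    sum, so that a single subsequence serves both.\<close>
  define x where "x = case_sum (\<lambda>ij k. X k $$ ij) (\<lambda>ij k. Y k $$ ij)"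
  define I where "I = ({..<n} \<times> {..<n}) <+> ({..<m} \<times> {..<m})"
  have "\<exists>r. strict_mono r \<and> (\<forall>i\<in>I. convergent (\<lambda>k. x i (r k)))"
    by (rule common_convergent_subsequence[of _ _ C]) (use X Y in \<open>auto simp: x_def I_def\<close>)
  then obtain r where r: "strict_mono r" and conv: "\<And>i. i \<in> I \<Longrightarrow> convergent (\<lambda>k. x i (r k))"
    by blast
  have "convergent (\<lambda>k. X (r k) $$ (i, j))" if "i < n" "j < n" for i j
    using conv[of "Inl (i, j)"] that by (auto simp: x_def I_def)
  then have "mat_tendsto n n (\<lambda>k. X (r k)) (mat n n (\<lambda>ij. lim (\<lambda>k. X (r k) $$ ij)))"
    using X by (simp add: mat_tendsto_def convergent_LIMSEQ_iff)
  moreover have "convergent (\<lambda>k. Y (r k) $$ (i, j))" if "i < m" "j < m" for i j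
    using conv[of "Inr (i, j)"] that by (auto simp: x_def I_def)
  then have "mat_tendsto m m (\<lambda>k. Y (r k)) (mat m m (\<lambda>ij. lim (\<lambda>k. Y (r k) $$ ij)))"
    using Y by (simp add: mat_tendsto_def convergent_LIMSEQ_iff)
  ultimately show ?thesis using that r by blast
qed

lemma Ups_vals_nonempty:
  assumes ch: "is_channel dA dB Es"
  shows "Ups_vals dA dB Es \<noteq> {}"
proof -
  define S where "S = ketbra dA 0 0"
  define T where "T = tensor S (1\<^sub>m dB)"
  note d = channel_dims[OF ch]
  have S: "S \<in> carrier_mat dA dA" by (simp add: S_def ketbra_carrier)
  have T: "T \<in> carrier_mat (dA * dB) (dA * dB)" using S by (simp add: T_def)
  \<comment> \<open>\<open>T\<close> is a Hermitian idempotent, which exhibits it as a congruence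
    image of the identity and hence as positive semidefinite.\<close>
  have "adj T * 1\<^sub>m (dA * dB) * T = T"
  proof (rule eq_matI)
    fix i j assume "i < dim_row T" "j < dim_col T"
    then have ij: "i < dA * dB" "j < dA * dB" using T by auto
    \<comment> \<open>In the Kronecker ordering \<open>T\<close> is the diagonal projection onto the
      first \<open>dB\<close> basis vectors.\<close>
    have ent: "T $$ (k, l) = (if k = l \<and> k < dB then 1 else 0)" if "k < dA * dB" "l < dA * dB" for k l
      using that S d
      by (auto simp: T_def tensor_def S_def ketbra_def less_mult_imp_div_less div_eq_0_iff)
    have "(adj T * T) $$ (i, j) = (\<Sum>k<dA * dB. adj T $$ (i, k) * T $$ (k, j))"
      by (rule mult_mat_index[OF adj_carrier[OF T] T ij])
    also have "\<dots> = (\<Sum>k<dA * dB. if k = i then T $$ (i, j) else 0)"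
      using ij T ent by (intro sum.cong) auto
    finally have "(adj T * T) $$ (i, j) = T $$ (i, j)" using ij by simp
    then show "(adj T * 1\<^sub>m (dA * dB) * T) $$ (i, j) = T $$ (i, j)"
      using right_mult_one_mat[OF adj_carrier[OF T]] by simp
  qed (use T in auto)
  moreover have "psd n (1\<^sub>m n)" for n
    by (auto simp: psd_def scalar_prod_def intro!: sum_nonneg)
  ultimately have psdT: "psd (dA * dB) T" using psd_congruence[OF _ T] by metis
  have TT: "T - T = 0\<^sub>m (dA * dB) (dA * dB)" using T by auto
  have "psd n (0\<^sub>m n n)" for n by (simp add: psd_def form_eq[OF zero_carrier_mat])
  moreover have "ptrace_A dA dB T = 1\<^sub>m dB"
  proof (rule eq_matI)
    fix b b' assume "b < dim_row (1\<^sub>m dB :: complex mat)" "b' < dim_col (1\<^sub>m dB :: complex mat)"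
    then have b: "b < dB" "b' < dB" by auto
    have "ptrace_A dA dB T $$ (b, b') = (\<Sum>a<dA. if a = 0 then (if b = b' then 1 else 0) else 0)"
      using b unfolding ptrace_A_def T_def
      by (auto simp: tensor_one_index[OF S] intro!: sum.cong) (auto simp: S_def ketbra_def)
    then show "ptrace_A dA dB T $$ (b, b') = 1\<^sub>m dB $$ (b, b')" using b d by simp
  qed (auto simp: ptrace_A_def)
  moreover have "mtrace (P_AB dA dB Es * (T - T)) = 0"
    unfolding TT using P_AB_props(1)[OF ch] by (simp add: mtrace_def)
  ultimately have "ups_feasible dA dB (P_AB dA dB Es) S T"
    using S T psdT unfolding ups_feasible_def T_def[symmetric] TT by simp
  then show ?thesis by (auto simp: Ups_vals_eq)
qed

lemma Ups_vals_max:
  assumes ch: "is_channel dA dB Es"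
  shows "\<exists>v. is_max (Ups_vals dA dB Es) v"
proof -
  let ?V = "Ups_vals dA dB Es" and ?P = "P_AB dA dB Es"
  note d = channel_dims[OF ch]
  obtain B where B: "\<And>S U. ups_feasible dA dB ?P S U \<Longrightarrow> Re (mtrace S) \<le> B"
    using ups_feasible_bounded[OF ch] by blast
  have bdd: "bdd_above ?V" using B by (auto simp: Ups_vals_eq bdd_above_def)
  \<comment> \<open>A maximizing sequence: feasible pairs whose trace comes within
    \<open>1 / Suc k\<close> of the supremum.\<close>
  have "\<exists>S U. ups_feasible dA dB ?P S U \<and> Sup ?V - 1 / Suc k < Re (mtrace S)" for k
  proof -
    have "\<exists>x\<in>?V. Sup ?V - 1 / Suc k < x"
      by (subst less_cSup_iff[symmetric, OF Ups_vals_nonempty[OF ch] bdd]) simp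
    then show ?thesis by (auto simp: Ups_vals_eq)
  qed
  then obtain SS UU where f: "\<And>k. ups_feasible dA dB ?P (SS k) (UU k)"
    and near: "\<And>k. Sup ?V - 1 / Suc k < Re (mtrace (SS k))" by metis
  \<comment> \<open>Entries are at most twice the trace: at most \<open>2 * dB * B\<close> for
    \<open>S \<otimes> 1\<close>, and \<open>2 * dB\<close> for \<open>U\<close>.\<close>
  define C where "C = max (2 * dB * B) (2 * dB)"
  note tr = ups_feasible_trace[OF f d(2)]
  have SSc: "SS k \<in> carrier_mat dA dA" and UUp: "psd (dA * dB) (UU k)" for k
    using f[of k] by (auto simp: ups_feasible_def)
  have bS: "cmod (SS k $$ (i, j)) \<le> C" if ij: "i < dA" "j < dA" for k i j
  proof -
    \<comment> \<open>Positivity is known for \<open>S \<otimes> 1\<close>, so the entry of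
      \<open>S\<close> is read off there at \<open>b = 0\<close>, an index that exists because
      \<open>dB\<close> is positive.\<close>
    have "SS k $$ (i, j) = tensor (SS k) (1\<^sub>m dB) $$ (i * dB + 0, j * dB + 0)"
      using tensor_one_index[OF SSc ij d(2) d(2)] by simp
    also have "cmod \<dots> \<le> 2 * Re (mtrace (tensor (SS k) (1\<^sub>m dB)))"
      using index_less_prod[OF ij(1) d(2)] index_less_prod[OF ij(2) d(2)]
      by (intro psd_entry_le_trace[OF tr(4)])
    also have "\<dots> = 2 * dB * Re (mtrace (SS k))" by (simp add: mtrace_tensor_one[OF SSc])
    also have "\<dots> \<le> 2 * dB * B" using B[OF f] by (intro mult_left_mono) auto
    finally show ?thesis by (simp add: C_def)
  qed
  have bU: "cmod (UU k $$ (i, j)) \<le> C" if "i < dA * dB" "j < dA * dB" for k i j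
    using psd_entry_le_trace[OF UUp that, of k] tr(1)[of k] by (simp add: C_def)
  obtain r S U where r: "strict_mono r" and S: "mat_tendsto dA dA (\<lambda>k. SS (r k)) S"
    and U: "mat_tendsto (dA * dB) (dA * dB) (\<lambda>k. UU (r k)) U"
    by (rule convergent_mat_subsequences[OF SSc bS psd_carrier[OF UUp] bU])
  have "ups_feasible dA dB ?P S U"
    by (rule ups_feasible_limit[OF S U P_AB_props(1)[OF ch] f])
  then have V: "Re (mtrace S) \<in> ?V" by (auto simp: Ups_vals_eq)
  have "(\<lambda>k. Sup ?V - 1 / Suc (r k)) \<longlonglongrightarrow> Sup ?V - 0"
    by (intro tendsto_diff tendsto_const)
       (use LIMSEQ_subseq_LIMSEQ[OF LIMSEQ_inverse_real_of_nat r] in \<open>simp add: o_def inverse_eq_divide\<close>)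
  then have "Sup ?V - 0 \<le> Re (mtrace S)"
    by (rule LIMSEQ_le[OF _ tendsto_Re[OF tendsto_mtrace[OF S]]]) (use near in \<open>auto intro: less_imp_le\<close>)
  then have "x \<le> Re (mtrace S)" if "x \<in> ?V" for x
    using cSup_upper[OF that bdd] by simp
  with V show ?thesis by (auto simp: is_max_def)
qed

subsection \<open>Scaling\<close>

lemma Greatest_is_max: "is_max S v \<Longrightarrow> (GREATEST x. x \<in> S) = v"
  by (auto simp: is_max_def intro: Greatest_equality)

lemma ptrace_smult:
  "U \<in> carrier_mat (dA * dB) (dA * dB) \<Longrightarrow> ptrace_A dA dB (c \<cdot>\<^sub>m U) = c \<cdot>\<^sub>m ptrace_A dA dB U"
  by (rule eq_matI) (auto simp: ptrace_A_def index_less_prod sum_distrib_left)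

lemma mtrace_smult: "mtrace (c \<cdot>\<^sub>m A) = c * mtrace A" if "A \<in> carrier_mat n n"
  using that by (simp add: mtrace_def sum_distrib_left)

lemma trace_tensor_minus_smult:
  assumes "P \<in> carrier_mat (dA * dB) (dA * dB)" "S \<in> carrier_mat dA dA" "U \<in> carrier_mat (dA * dB) (dA * dB)"
  shows "tensor (c \<cdot>\<^sub>m S) (1\<^sub>m dB) - c \<cdot>\<^sub>m U = c \<cdot>\<^sub>m (tensor S (1\<^sub>m dB) - U)"
    and "mtrace (P * (c \<cdot>\<^sub>m (tensor S (1\<^sub>m dB) - U))) = c * mtrace (P * (tensor S (1\<^sub>m dB) - U))"
proof -
  note T = tensor_one_carrier[OF assms(2), of dB]
  have TU: "tensor S (1\<^sub>m dB) - U \<in> carrier_mat (dA * dB) (dA * dB)"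
    using assms(3) by (rule minus_carrier_mat)
  show "tensor (c \<cdot>\<^sub>m S) (1\<^sub>m dB) - c \<cdot>\<^sub>m U = c \<cdot>\<^sub>m (tensor S (1\<^sub>m dB) - U)"
    unfolding tensor_one_smult[OF assms(2)]
    using T assms(3) by (intro eq_matI) (auto simp: right_diff_distrib)
  show "mtrace (P * (c \<cdot>\<^sub>m (tensor S (1\<^sub>m dB) - U))) = c * mtrace (P * (tensor S (1\<^sub>m dB) - U))"
    using mult_smult_distrib[OF assms(1) TU] mtrace_smult[OF mult_carrier_mat[OF assms(1) TU]] by simp
qed

lemma trace_proj_swap:
  assumes P: "P \<in> carrier_mat n n" and W: "W \<in> carrier_mat n n" and T: "T \<in> carrier_mat n n"
  shows "mtrace (P * (W - T)) = - mtrace (P * (T - W))"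
  using mult_minus_distrib_mat[OF P W T] mult_minus_distrib_mat[OF P T W]
    mtrace_minus[OF mult_carrier_mat[OF P W] mult_carrier_mat[OF P T]]
    mtrace_minus[OF mult_carrier_mat[OF P T] mult_carrier_mat[OF P W]] by simp

lemma is_max_DNS_iff:
  assumes ch: "is_channel dA dB Es" and k: "0 < k"
  shows "is_max (DNS_vals dA dB Es k) 0 \<longleftrightarrow> k\<^sup>2 \<in> Ups_vals dA dB Es"
proof
  let ?P = "P_AB dA dB Es"
  note P = P_AB_props[OF ch]
  {
    assume "is_max (DNS_vals dA dB Es k) 0"
    then have "0 \<in> DNS_vals dA dB Es k" by (simp add: is_max_def)
    then obtain W \<rho> where re: "Re (mtrace (?P * (W - tensor \<rho> (1\<^sub>m dB)))) = 0"
      and W: "W \<in> carrier_mat (dA * dB) (dA * dB)" "psd (dA * dB) W"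
      and \<rho>: "\<rho> \<in> carrier_mat dA dA" "mtrace \<rho> = 1"
      and TW: "psd (dA * dB) (tensor \<rho> (1\<^sub>m dB) - W)"
      and pt: "ptrace_A dA dB W = complex_of_real (1 / k\<^sup>2) \<cdot>\<^sub>m 1\<^sub>m dB"
      by (auto simp: DNS_vals_def loewner_le_def)
    let ?c = "complex_of_real (k\<^sup>2)"
    note sm = trace_tensor_minus_smult[OF P(1) \<rho>(1) W(1), of ?c]
    \<comment> \<open>The program for \<open>DNS\<close> records only a real part; the imaginary
      part vanishes because the slack is positive semidefinite.\<close>
    have "mtrace (?P * (tensor \<rho> (1\<^sub>m dB) - W)) = 0"
      using trace_proj_psd(1)[OF P(1-3) TW] re trace_proj_swap[OF P(1) W(1) tensor_one_carrier[OF \<rho>(1)]]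
      by (simp add: complex_eq_iff)
    moreover have "ptrace_A dA dB (?c \<cdot>\<^sub>m W) = 1\<^sub>m dB"
      unfolding ptrace_smult[OF W(1)] pt using k by (intro eq_matI) auto
    ultimately have "ups_feasible dA dB ?P (?c \<cdot>\<^sub>m \<rho>) (?c \<cdot>\<^sub>m W)"
      using psd_smult[OF W(2), of "k\<^sup>2"] psd_smult[OF TW, of "k\<^sup>2"] W \<rho>
      by (simp add: ups_feasible_def sm del: of_real_power)
    moreover have "Re (mtrace (?c \<cdot>\<^sub>m \<rho>)) = k\<^sup>2" by (simp add: mtrace_smult[OF \<rho>(1)] \<rho>(2) del: of_real_power)
    ultimately show "k\<^sup>2 \<in> Ups_vals dA dB Es" unfolding Ups_vals_eq by force
  }
  assume "k\<^sup>2 \<in> Ups_vals dA dB Es"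
  then obtain S U where f: "ups_feasible dA dB ?P S U" and trS: "k\<^sup>2 = Re (mtrace S)"
    by (auto simp: Ups_vals_eq)
  have S: "S \<in> carrier_mat dA dA" and U: "U \<in> carrier_mat (dA * dB) (dA * dB)" "psd (dA * dB) U"
    and TU: "psd (dA * dB) (tensor S (1\<^sub>m dB) - U)" and pt: "ptrace_A dA dB U = 1\<^sub>m dB"
    and zero: "mtrace (?P * (tensor S (1\<^sub>m dB) - U)) = 0"
    using f by (auto simp: ups_feasible_def)
  let ?c = "complex_of_real (1 / k\<^sup>2)"
  note sm = trace_tensor_minus_smult[OF P(1) S U(1), of ?c]
  have cS: "?c \<cdot>\<^sub>m S \<in> carrier_mat dA dA" and cU: "?c \<cdot>\<^sub>m U \<in> carrier_mat (dA * dB) (dA * dB)"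
    using S U by auto
  \<comment> \<open>\<open>Ups_vals\<close> records only the real part of the trace; as the trace is
    real, it is exactly \<open>k\<^sup>2\<close>, and scaling normalizes it to 1.\<close>
  have "mtrace S = complex_of_real (k\<^sup>2)"
    using ups_feasible_trace(2)[OF f channel_dims(2)[OF ch]] trS by (simp add: complex_eq_iff del: of_real_power)
  then have tr1: "mtrace (?c \<cdot>\<^sub>m S) = 1" using k by (simp add: mtrace_smult[OF S])
  have "mtrace (?P * (?c \<cdot>\<^sub>m U - tensor (?c \<cdot>\<^sub>m S) (1\<^sub>m dB))) = 0"
    unfolding trace_proj_swap[OF P(1) cU tensor_one_carrier[OF cS]] sm zero by simp
  moreover have "loewner_le (dA * dB) (?c \<cdot>\<^sub>m U) (tensor (?c \<cdot>\<^sub>m S) (1\<^sub>m dB))"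
    unfolding loewner_le_def sm(1) using cU tensor_one_carrier[OF cS] psd_smult[OF TU, of "1 / k\<^sup>2"] by simp
  moreover have "psd (dA * dB) (?c \<cdot>\<^sub>m U)" by (rule psd_smult[OF U(2)]) simp
  moreover have "ptrace_A dA dB (?c \<cdot>\<^sub>m U) = ?c \<cdot>\<^sub>m 1\<^sub>m dB" by (simp only: ptrace_smult[OF U(1)] pt)
  ultimately have "0 \<in> DNS_vals dA dB Es k"
    unfolding DNS_vals_def using cS cU tr1
    by (intro CollectI exI[of _ "?c \<cdot>\<^sub>m U"] exI[of _ "?c \<cdot>\<^sub>m S"]) (simp del: of_real_divide)
  \<comment> \<open>Every feasible pair has a nonpositive value, so attaining 0 already makes 0 the
    maximum.\<close>
  moreover have "x \<le> 0" if x: "x \<in> DNS_vals dA dB Es k" for x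
  proof -
    obtain W \<rho> where "x = Re (mtrace (?P * (W - tensor \<rho> (1\<^sub>m dB))))"
      and W: "W \<in> carrier_mat (dA * dB) (dA * dB)" and \<rho>: "\<rho> \<in> carrier_mat dA dA"
      and TW: "psd (dA * dB) (tensor \<rho> (1\<^sub>m dB) - W)"
      using x by (auto simp: DNS_vals_def loewner_le_def)
    then show ?thesis
      using trace_proj_psd(2)[OF P(1-3) TW] trace_proj_swap[OF P(1) W tensor_one_carrier[OF \<rho>]] by simp
  qed
  ultimately show "is_max (DNS_vals dA dB Es k) 0" by (simp add: is_max_def)
qed

theorem theorem2:
  fixes dA dB :: nat and Es :: "complex mat list"
  assumes "is_channel dA dB Es"
  shows "kappa_NS dA dB Es = sqrt (Upsilon dA dB Es) \<and>
         QNS0 dA dB Es = \<lfloor>sqrt (Upsilon dA dB Es)\<rfloor>"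
proof -
  obtain v where v: "is_max (Ups_vals dA dB Es) v" using Ups_vals_max[OF assms] by blast
  then have "v \<in> Ups_vals dA dB Es" by (simp add: is_max_def)
  \<comment> \<open>This makes \<open>sqrt v\<close> positive, as the range of \<open>k\<close> in
    \<open>kappa_NS\<close> requires.\<close>
  then have "1 \<le> v"
    using ups_feasible_trace(3)[OF _ channel_dims(2)[OF assms]] by (auto simp: Ups_vals_eq)
  have "(GREATEST k. 0 < k \<and> is_max (DNS_vals dA dB Es k) 0) = sqrt v"
  proof (rule Greatest_equality)
    show "0 < sqrt v \<and> is_max (DNS_vals dA dB Es (sqrt v)) 0"
      using \<open>1 \<le> v\<close> \<open>v \<in> _\<close> is_max_DNS_iff[OF assms, of "sqrt v"] by simp
  next
    fix k assume "0 < k \<and> is_max (DNS_vals dA dB Es k) 0"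
    \<comment> \<open>Every admissible \<open>k\<close> contributes the value
      \<open>k\<^sup>2\<close> to the program for \<open>Upsilon\<close>, whose maximum is
      \<open>v\<close>.\<close>
    then have "k\<^sup>2 \<le> v" using is_max_DNS_iff[OF assms, of k] v by (simp add: is_max_def)
    then show "k \<le> sqrt v" by (rule real_le_rsqrt)
  qed
  moreover have "Upsilon dA dB Es = v" unfolding Upsilon_def by (rule Greatest_is_max[OF v])
  ultimately show ?thesis by (simp add: kappa_NS_def QNS0_def)
qed

end
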